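(* Let $A,B\in\mathbb{C}[t]$ with $\deg(A)=5$. Then the Abel equation $x'=A(t)x^3+B(t)x^2$ has at most five rational solutions.
   Context: A rational solution means a solution $x(t)=q(t)/p(t)$ of the equation with $p,q\in\mathbb{C}[t]$ coprime, $q\not\equiv 0$ and $p$ non-constant; in particular the trivial solution $x(t)\equiv 0$ is not counted. *)

theory Defs
  imports Complex_Main "HOL-Computational_Algebra.Computational_Algebra"
begin

text \<open>
  A solution is taken as a function of the complex variable and has to satisfy the equation
  at every point where the reduced denominator \<open>p\<close> does not vanish. At the zeros of \<open>p\<close> (the poles)
  the convention \<open>y / 0 = 0\<close> fixes the value 0; since \<open>p\<close> and \<open>q\<close> are coprime, two of these
  total functions are equal iff the rational functions \<open>q / p\<close> are equal, so counting the
  functions below is counting rational functions.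
\<close>

definition rational_solution ::
  "complex poly \<Rightarrow> complex poly \<Rightarrow> (complex \<Rightarrow> complex) \<Rightarrow> bool" where
  "rational_solution A B x \<longleftrightarrow>
    (\<exists>p q :: complex poly. coprime p q \<and> q \<noteq> 0 \<and> degree p > 0 \<and>
       x = (\<lambda>t. poly q t / poly p t) \<and>
       (\<forall>t. poly p t \<noteq> 0 \<longrightarrow>
          (x has_field_derivative (poly A t * x t ^ 3 + poly B t * x t ^ 2)) (at t)))"

end

theory Submission
  imports Defs "HOL-Computational_Algebra.Field_as_Ring"
begin

text \<open>
  A rational solution is \<open>1 / p\<close> for a polynomial \<open>p\<close> with \<open>p p' + B p + A = 0\<close>; in particular
  \<open>p\<close> divides \<open>A\<close>. Eliminating \<open>B\<close> between two such polynomials gives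
  \<open>p q (q - p)' = A (q - p)\<close>, so \<open>deg p + deg q = 6\<close> and
  \<open>lc A = lc p \<cdot> lc q \<cdot> deg (q - p)\<close>. If there are at least three solutions, all of them are
  therefore cubic, and comparing leading coefficients shows that all but at most one share the same
  leading coefficient \<open>c\<close>, while \<open>deg (q - p) = k\<close> is the same (1 or 2) for all pairs of these.

  Fix one of them, \<open>p\<close>, and put \<open>h = A / p\<close>; then \<open>h (q - p) = q (q - p)'\<close> for every other \<open>q\<close>.
  If \<open>k = 1\<close>, this forces \<open>q = h (t - m)\<close> with \<open>m\<close> a root of \<open>p\<close>: three choices. If \<open>k = 2\<close>, write
  \<open>h = 2 u\<close> and \<open>q - p = e ((t - m)\<^sup>2 - n)\<close>. Either \<open>n = 0\<close>, \<open>p(m) = 0\<close> and \<open>u(m) = p'(m)\<close>, or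
  \<open>n \<noteq> 0\<close>, \<open>u(m) = 0\<close> and \<open>m\<close> is the midpoint of two roots of \<open>p\<close>. Each kind allows at most two
  values of \<open>m\<close>, and two of the second kind leave room for only one of the first: again three choices.
\<close>

section \<open>Reduction to polynomial solutions of
  \<open>p * pderiv p + B * p + A = 0\<close>\<close>

text \<open>Clearing denominators shows that \<open>q\<close> divides
  \<open>p * p * pderiv q\<close>, hence \<open>pderiv q\<close> by coprimality. In characteristic
  zero this forces \<open>q\<close> to be constant, and the constant is absorbed into
  \<open>p\<close>.\<close>

lemma rational_solution_imp_reciprocal:
  assumes "rational_solution A B x"
  shows "\<exists>p. p * pderiv p + B * p + A = 0 \<and> x = (\<lambda>t. 1 / poly p t)"
proof -
  obtain p q where pq: "coprime p q" "q \<noteq> 0" "degree p > 0"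
    and x: "x = (\<lambda>t. poly q t / poly p t)"
    and ode: "\<And>t. poly p t \<noteq> 0 \<Longrightarrow>
      (x has_field_derivative (poly A t * x t ^ 3 + poly B t * x t ^ 2)) (at t)"
    using assms unfolding rational_solution_def by blast
  have "p \<noteq> 0"
    using pq(3) by auto
  have "p * (p * (pderiv q * p - q * pderiv p)) = p * (A * q ^ 3 + B * q ^ 2 * p)"
  proof (rule poly_eq_poly_eq_iff[THEN iffD1, OF ext])
    fix t
    show "poly (p * (p * (pderiv q * p - q * pderiv p))) t =
      poly (p * (A * q ^ 3 + B * q ^ 2 * p)) t"
    proof (cases "poly p t = 0")
      case False
      have "(x has_field_derivative
          (poly (pderiv q) t * poly p t - poly q t * poly (pderiv p) t) / (poly p t * poly p t)) (at t)"
        unfolding x by (rule DERIV_divide[OF poly_DERIV poly_DERIV False])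
      from DERIV_unique[OF this ode[OF False]]
      have "poly (pderiv q) t * poly p t - poly q t * poly (pderiv p) t =
          (poly p t * poly p t) * (poly A t * (poly q t / poly p t) ^ 3 + poly B t * (poly q t / poly p t) ^ 2)"
        using False by (simp add: x field_simps)
      also have "poly p t * \<dots> = poly A t * poly q t ^ 3 + poly B t * poly q t ^ 2 * poly p t"
        using False by (simp add: power2_eq_square power3_eq_cube field_simps)
      finally show ?thesis
        by simp
    qed simp
  qed
  then have eq: "p * (pderiv q * p - q * pderiv p) = A * q ^ 3 + B * q ^ 2 * p"
    using \<open>p \<noteq> 0\<close> by simp
  have "p * p * pderiv q = q * (p * pderiv p + A * q\<^sup>2 + B * q * p)"
    using eq by algebra
  then have "q dvd p * p * pderiv q"
    by (rule dvdI)
  moreover have "coprime q (p * p)"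
    using pq(1) by (simp add: coprime_commute)
  ultimately have "q dvd pderiv q"
    by (simp only: coprime_dvd_mult_right_iff)
  then have "degree q = 0"
    using not_dvd_pderiv by blast
  then obtain a where q: "q = [:a:]"
    by (rule degree_eq_zeroE)
  have a: "a \<noteq> 0"
    using pq(2) q by auto
  define P where "P = smult (1 / a) p"
  have p: "p = [:a:] * P"
    using a by (simp add: P_def)
  have "pderiv q = 0" "pderiv p = [:a:] * pderiv P"
    by (simp_all add: p q pderiv_smult pderiv_pCons)
  then have "[:a:] * P * (0 * ([:a:] * P) - [:a:] * ([:a:] * pderiv P)) =
      A * [:a:] ^ 3 + B * [:a:] ^ 2 * ([:a:] * P)"
    using eq p q by metis
  then have "[:a:] ^ 3 * (P * pderiv P + B * P + A) = 0"
    by algebra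
  then have "P * pderiv P + B * P + A = 0"
    using a by simp
  moreover have "x = (\<lambda>t. 1 / poly P t)"
    using a by (auto simp: P_def x q)
  ultimately show ?thesis
    by blast
qed

section \<open>Degrees and leading coefficients of differences of solutions\<close>

text \<open>Subtracting \<open>q\<close> times the equation for \<open>p\<close> from
  \<open>p\<close> times the equation for \<open>q\<close> removes \<open>B\<close>.\<close>

lemma reciprocal_solutions_diff:
  fixes A B p q :: "complex poly"
  assumes "p * pderiv p + B * p + A = 0" and "q * pderiv q + B * q + A = 0"
  shows "p * q * pderiv (q - p) = A * (q - p)"
proof -
  have "pderiv p * p = - A - B * p" "pderiv q * q = - A - B * q"
    using assms by (auto simp: algebra_simps eq_neg_iff_add_eq_0)
  then show ?thesis
    unfolding pderiv_diff by algebra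
qed

lemma pderiv_lead_coeff:
  fixes d :: "complex poly"
  assumes "degree d > 0"
  shows "pderiv d \<noteq> 0" "lead_coeff (pderiv d) = of_nat (degree d) * lead_coeff d"
  using assms by (auto simp: pderiv_eq_0_iff degree_pderiv coeff_pderiv)

text \<open>Both sides of \<open>p * q * pderiv d = A * d\<close> with \<open>d = q - p\<close> are
  compared: differentiation lowers the degree of \<open>d\<close> by one and multiplies its leading
  coefficient by that degree. As \<open>A * d\<close> is nonzero, \<open>d\<close> cannot be
  constant.\<close>

lemma reciprocal_solutions_degree:
  fixes A B p q :: "complex poly"
  assumes "p * pderiv p + B * p + A = 0" "q * pderiv q + B * q + A = 0"
    and "p \<noteq> q" "A \<noteq> 0"
  shows "degree (q - p) > 0" "degree p + degree q = degree A + 1"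
    "lead_coeff A = lead_coeff p * lead_coeff q * of_nat (degree (q - p))"
proof -
  define d where "d = q - p"
  have d0: "d \<noteq> 0" using assms d_def by auto
  have eq: "p * q * pderiv d = A * d"
    using reciprocal_solutions_diff[OF assms(1,2)] d_def by simp
  have ne: "p \<noteq> 0" "q \<noteq> 0" "pderiv d \<noteq> 0"
    using eq assms d0 by auto
  then have "degree d > 0"
    by (simp add: pderiv_eq_0_iff)
  then show "degree (q - p) > 0" by (simp add: d_def)
  have "degree p + degree q + (degree d - 1) = degree A + degree d"
    using arg_cong[OF eq, of degree] ne d0 assms(4) by (simp add: degree_mult_eq degree_pderiv)
  with \<open>degree d > 0\<close> show "degree p + degree q = degree A + 1"
    by simp
  have "lead_coeff p * lead_coeff q * (of_nat (degree d) * lead_coeff d) = lead_coeff A * lead_coeff d"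
    using arg_cong[OF eq, of lead_coeff] pderiv_lead_coeff[OF \<open>degree d > 0\<close>] by (simp add: lead_coeff_mult)
  then show "lead_coeff A = lead_coeff p * lead_coeff q * of_nat (degree (q - p))"
    using d0 unfolding d_def[symmetric] mult.assoc[symmetric] by simp
qed

section \<open>Midpoints of the roots of a cubic\<close>

text \<open>
  Here \<open>p\<close> has roots \<open>r\<close>, \<open>w1\<close>, \<open>w2\<close>, and the roots of \<open>u\<close> are the midpoints of \<open>r\<close> and \<open>w2\<close> and of
  \<open>r\<close> and \<open>w1\<close>, so \<open>u\<close> is determined by \<open>p\<close>.
\<close>
lemma tangent_root_unique:
  fixes p u :: "complex poly"
  assumes c: "c \<noteq> 0" and m: "m \<noteq> w"
    and u: "u = smult c ([:- m, 1:] * [:- w, 1:])"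
    and p1: "p = smult c ([:- w1, 1:] * [:m\<^sup>2 - n1, - 2 * m, 1:])" and n1: "n1 \<noteq> 0"
    and p2: "p = smult c ([:- w2, 1:] * [:w\<^sup>2 - n2, - 2 * w, 1:])" and n2: "n2 \<noteq> 0"
    and x: "poly p x = 0" "poly u x = poly (pderiv p) x"
    and y: "poly p y = 0" "poly u y = poly (pderiv p) y"
  shows "x = y"
proof -
  \<comment> \<open>The coefficients of t^2 compare the sums of the roots in the two factorizations
    of \<open>p\<close>.\<close>
  have "c * (w1 + 2 * m) = c * (w2 + 2 * w)"
    using arg_cong[OF p1[symmetric, unfolded p2], of "\<lambda>p. coeff p 2"]
    by (simp add: numeral_2_eq_2 algebra_simps)
  then have sum: "w1 + 2 * m = w2 + 2 * w"
    using c mult_left_cancel by blast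
  have "poly p w2 = 0" unfolding p2 poly_smult poly_mult by simp
  moreover have "poly p w2 = c * ((w2 - w1) * ((w2 - m)\<^sup>2 - n1))"
    unfolding p1 poly_smult poly_mult by (simp add: power2_eq_square algebra_simps)
  ultimately have "(w2 - w1) * ((w2 - m)\<^sup>2 - n1) = 0"
    using c by simp
  moreover have "w2 \<noteq> w1" using sum m by auto
  ultimately have n1': "n1 = (w2 - m)\<^sup>2" by simp
  \<comment> \<open>Since \<open>w2\<close> is a root of the quadratic factor centred at
    \<open>m\<close>, its reflection in \<open>m\<close> is the other root of that factor.\<close>
  define r where "r = 2 * m - w2"
  have mr: "m = (r + w2) / 2" and wr: "w = (r + w1) / 2"
    using sum by (auto simp: r_def field_simps)
  have r2: "r \<noteq> w2" using n1 n1' by (auto simp: r_def)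
  have pr: "p = smult c ([:- w1, 1:] * [:- w2, 1:] * [:- r, 1:])"
    unfolding p1 n1' by (simp add: r_def power2_eq_square algebra_simps)
  have r1: "r \<noteq> w1"
  proof
    assume "r = w1"
    then have "w = w1" by (simp add: wr)
    have "poly p w1 = 0" unfolding p1 poly_smult poly_mult by simp
    moreover have "poly p w1 = - c * ((w1 - w2) * n2)"
      unfolding p2 \<open>w = w1\<close> poly_smult poly_mult by (simp add: power2_eq_square algebra_simps)
    ultimately have "(w1 - w2) * n2 = 0"
      using c by simp
    then show False using \<open>w2 \<noteq> w1\<close> n2 by simp
  qed
  have roots: "z = r \<or> z = w1 \<or> z = w2" if "poly p z = 0" for z
    using that c unfolding pr poly_smult poly_mult by auto
  have pd: "poly (pderiv p) z = c * ((z - w1) * (z - w2) + (z - w1) * (z - r) + (z - w2) * (z - r))" for z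
    by (simp add: pr pderiv_smult pderiv_mult pderiv_pCons algebra_simps)
  \<comment> \<open>At \<open>r\<close> the condition reduces to (r - w1)(r - w2) = 0, which fails.
    At \<open>w1\<close> and \<open>w2\<close> one linear relation each remains, and the two
    relations together would give \<open>w1 = w2\<close>.\<close>
  have key: "z = w1 \<and> 2 * w1 = 3 * w2 - r \<or> z = w2 \<and> 2 * w2 = 3 * w1 - r"
    if z: "poly p z = 0" "poly u z = poly (pderiv p) z" for z
  proof -
    have pu: "poly u z = c * ((z - m) * (z - w))"
      unfolding u poly_smult poly_mult by simp
    have *: "(z - m) * (z - w) = (z - w1) * (z - w2) + (z - w1) * (z - r) + (z - w2) * (z - r)"
      using z(2) c unfolding pd pu by simp
    consider "z = r" | "z = w1" | "z = w2" using roots z(1) by blast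
    then show ?thesis
    proof cases
      case 1
      have "(r - w1) * (r - w2) * 3 = 0"
        using * unfolding 1 mr wr by (simp add: field_simps)
      then show ?thesis using r1 r2 by simp
    next
      case 2
      have "(w1 - r) * (2 * w1 - (3 * w2 - r)) = 0"
        using * unfolding 2 mr wr by (simp add: field_simps)
      then show ?thesis using r1 2 by auto
    next
      case 3
      have "(w2 - r) * (2 * w2 - (3 * w1 - r)) = 0"
        using * unfolding 3 mr wr by (simp add: field_simps)
      then show ?thesis using r2 3 by auto
    qed
  qed
  have False if "2 * w1 = 3 * w2 - r" "2 * w2 = 3 * w1 - r"
  proof -
    have "5 * (w1 - w2) = 0" using that by algebra
    then show False using \<open>w2 \<noteq> w1\<close> by simp
  qed
  then show ?thesis
    using key[OF x] key[OF y] by blast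
qed

section \<open>Elementary facts on cardinalities, roots and linear factors\<close>

lemma two_distinct_elements:
  assumes "finite S" "card S \<ge> 2"
  shows "\<exists>x\<in>S. \<exists>y\<in>S. x \<noteq> y"
proof (rule ccontr)
  assume "\<not> ?thesis"
  then have "card S \<le> Suc 0"
    unfolding card_le_Suc0_iff_eq[OF assms(1)] by blast
  then show False
    using assms(2) by simp
qed

lemma finite_card_roots_le:
  fixes p :: "complex poly"
  assumes "p \<noteq> 0" "R \<subseteq> {x. poly p x = 0}" "degree p \<le> n"
  shows "finite R" "card R \<le> n"
proof -
  show "finite R"
    using finite_subset[OF assms(2) poly_roots_finite[OF assms(1)]] .
  show "card R \<le> n"
    using card_mono[OF poly_roots_finite[OF assms(1)] assms(2)] card_poly_roots_bound[OF assms(1)] assms(3)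
    by linarith
qed

lemma linear_factor_degree:
  fixes p v :: "complex poly"
  assumes "p = [:- m, 1:] * v" "p \<noteq> 0"
  shows "v \<noteq> 0" "degree p = Suc (degree v)" "lead_coeff v = lead_coeff p"
proof -
  show v: "v \<noteq> 0"
    using assms by auto
  have "[:- m, 1:] \<noteq> 0"
    by simp
  then show "degree p = Suc (degree v)"
    unfolding assms(1) using v by (subst degree_mult_eq) auto
  show "lead_coeff v = lead_coeff p"
    unfolding assms(1) lead_coeff_mult by simp
qed

section \<open>Solutions that differ from a fixed one by a quadratic\<close>

text \<open>Each \<open>q\<close> is determined by its centre \<open>m\<close>, which lies in
  \<open>R1\<close> if n = 0 and in \<open>R2\<close> otherwise. Both sets have at most two
  elements, and \<open>tangent_root_unique\<close> excludes that both have two.\<close>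

lemma card_quadratic_steps:
  fixes p u :: "complex poly"
  assumes p: "degree p = 3" "lead_coeff p = c" and u: "degree u = 2" "lead_coeff u = c"
    and T: "\<And>q. q \<in> T \<Longrightarrow>
      \<exists>e m n. q = p + smult e [:m\<^sup>2 - n, - 2 * m, 1:] \<and>
        u * [:m\<^sup>2 - n, - 2 * m, 1:] = q * [:- m, 1:]"
  shows "finite T \<and> card T \<le> 3"
proof -
  have c: "c \<noteq> 0"
    using u leading_coeff_0_iff[of u] by (metis degree_0 zero_neq_numeral)
  then have u0: "u \<noteq> 0"
    using u(2) by auto
  have lin_ne: "[:- m, 1:] \<noteq> 0" for m :: complex
    by simp
  \<comment> \<open>This is the case of nonzero \<open>n\<close>. Comparing coefficients of
    \<open>p\<close> shows that \<open>m\<close> fixes \<open>r\<close> and \<open>n\<close>, hence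
    \<open>q\<close>, so \<open>SOME q. Q m q\<close> below recovers the right polynomial.\<close>
  define Q where "Q m q \<longleftrightarrow> (\<exists>r n. n \<noteq> 0 \<and>
    p = smult c ([:- r, 1:] * [:m\<^sup>2 - n, - 2 * m, 1:]) \<and>
    u * [:m\<^sup>2 - n, - 2 * m, 1:] = q * [:- m, 1:])" for m q
  define R1 where "R1 = {m. poly p m = 0 \<and> poly u m = poly (pderiv p) m}"
  define R2 where "R2 = {m. poly u m = 0 \<and> (\<exists>q. Q m q)}"
  have Q_unique: "q = q'" if Qs: "Q m q" "Q m q'" for m q q'
  proof -
    obtain r n where 1: "p = smult c ([:- r, 1:] * [:m\<^sup>2 - n, - 2 * m, 1:])"
      "u * [:m\<^sup>2 - n, - 2 * m, 1:] = q * [:- m, 1:]"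
      using Qs(1) unfolding Q_def by blast
    obtain r' n' where 2: "p = smult c ([:- r', 1:] * [:m\<^sup>2 - n', - 2 * m, 1:])"
      "u * [:m\<^sup>2 - n', - 2 * m, 1:] = q' * [:- m, 1:]"
      using Qs(2) unfolding Q_def by blast
    have "[:- r, 1:] * [:m\<^sup>2 - n, - 2 * m, 1:] = [:- r', 1:] * [:m\<^sup>2 - n', - 2 * m, 1:]"
      using smult_cancel[OF c] 1(1) 2(1) by metis
    then have "r = r' \<and> n = n'"
      by (simp add: algebra_simps) (auto simp: algebra_simps)
    then have "q * [:- m, 1:] = q' * [:- m, 1:]"
      using 1(2) 2(2) by metis
    then show ?thesis
      by (rule mult_right_cancel[OF lin_ne[of m], THEN iffD1])
  qed
  have sub: "T \<subseteq> (\<lambda>m. u * [:- m, 1:]) ` R1 \<union> (\<lambda>m. SOME q. Q m q) ` R2"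
  proof
    fix q assume "q \<in> T"
    then obtain e m n where q: "q = p + smult e [:m\<^sup>2 - n, - 2 * m, 1:]"
      and uq: "u * [:m\<^sup>2 - n, - 2 * m, 1:] = q * [:- m, 1:]"
      using T by meson
    show "q \<in> (\<lambda>m. u * [:- m, 1:]) ` R1 \<union> (\<lambda>m. SOME q. Q m q) ` R2"
    proof (cases "n = 0")
      case True
      have sq: "[:m\<^sup>2 - n, - 2 * m, 1:] = [:- m, 1:] * [:- m, 1:]"
        using True by (simp add: power2_eq_square)
      have "u * [:- m, 1:] * [:- m, 1:] = q * [:- m, 1:]"
        using uq by (simp only: sq mult.assoc)
      then have qu: "q = u * [:- m, 1:]"
        by (rule mult_right_cancel[OF lin_ne[of m], THEN iffD1, symmetric])
      \<comment> \<open>The value and the derivative at \<open>m\<close> can be read off here: the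
        subtracted term vanishes there to second order.\<close>
      have pm: "p = u * [:- m, 1:] - smult e ([:- m, 1:] * [:- m, 1:])"
        using q unfolding sq qu[symmetric] by (metis add_diff_cancel_right')
      have "m \<in> R1"
        unfolding R1_def pm mem_Collect_eq pderiv_diff pderiv_smult pderiv_mult
          poly_diff poly_smult poly_mult poly_add by (simp add: pderiv_pCons)
      then show ?thesis using qu by blast
    next
      case False
      \<comment> \<open>The quadratic factor takes the nonzero value -n at \<open>m\<close>, so
        \<open>u\<close> must vanish there.\<close>
      have "poly (u * [:m\<^sup>2 - n, - 2 * m, 1:]) m = 0"
        unfolding uq by simp
      then have um: "poly u m = 0"
        using False by (simp add: power2_eq_square algebra_simps)
      then obtain v where v: "u = [:- m, 1:] * v"
        by (auto simp: poly_eq_0_iff_dvd)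
      have "degree v = 1" "lead_coeff v = c"
        using linear_factor_degree[OF v u0] u by simp_all
      then obtain b where b: "v = [:b, c:]"
        by (metis degree1_coeffs[of v] lead_coeff_pCons(2) coeff_pCons_0 coeff_pCons_Suc degree_pCons_eq_if One_nat_def pCons_eq_0_iff)
      have "v * [:m\<^sup>2 - n, - 2 * m, 1:] * [:- m, 1:] = q * [:- m, 1:]"
        using uq unfolding v by (simp only: ac_simps)
      then have "q = v * [:m\<^sup>2 - n, - 2 * m, 1:]"
        by (rule mult_right_cancel[OF lin_ne[of m], THEN iffD1, symmetric])
      then have "p = v * [:m\<^sup>2 - n, - 2 * m, 1:] - smult e [:m\<^sup>2 - n, - 2 * m, 1:]"
        using q by (metis add_diff_cancel_right')
      also have "\<dots> = [:b - e, c:] * [:m\<^sup>2 - n, - 2 * m, 1:]"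
        by (simp add: b algebra_simps)
      also have "[:b - e, c:] = smult c [:- ((e - b) / c), 1:]"
        using c by simp
      finally have "Q m q"
        using False uq unfolding Q_def mult_smult_left by blast
      then show ?thesis
        using um Q_unique[OF someI[of "Q m"]] unfolding R2_def by blast
    qed
  qed
  \<comment> \<open>The coefficients of t^2 are c in \<open>u\<close> and 3c in
    \<open>pderiv p\<close>, so the polynomial whose roots contain \<open>R1\<close> is not
    zero.\<close>
  have "coeff (u - pderiv p) 2 = - 2 * c"
    using p u by (simp add: coeff_pderiv numeral_2_eq_2 numeral_3_eq_3)
  then have "u - pderiv p \<noteq> 0"
    using c by auto
  moreover have "degree (u - pderiv p) \<le> 2"
    using p u by (intro degree_diff_le) (auto simp: degree_pderiv)
  moreover have "R1 \<subseteq> {x. poly (u - pderiv p) x = 0}"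
    by (auto simp: R1_def)
  ultimately have R1: "finite R1" "card R1 \<le> 2"
    using finite_card_roots_le by blast+
  have R2: "finite R2" "card R2 \<le> 2"
    using finite_card_roots_le[OF u0, of R2 2] u(1) unfolding R2_def by auto
  have R: "card R1 + card R2 \<le> 3"
  proof (rule ccontr)
    assume "\<not> ?thesis"
    then have "card R1 \<ge> 2" "card R2 \<ge> 2"
      using R1 R2 by linarith+
    then obtain x y m w where xy: "x \<in> R1" "y \<in> R1" "x \<noteq> y" and mw: "m \<in> R2" "w \<in> R2" "m \<noteq> w"
      using two_distinct_elements[of R1] two_distinct_elements[of R2] R1(1) R2(1) by blast
    have "u = smult c ([:- m, 1:] * [:- w, 1:])"
    proof -
      obtain v where v: "u = [:- m, 1:] * v"
        using mw by (auto simp: R2_def poly_eq_0_iff_dvd)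
      have "poly u w = 0"
        using mw by (simp add: R2_def)
      then have "(w - m) * poly v w = 0"
        unfolding v poly_mult by simp
      then have "poly v w = 0"
        using mw(3) by simp
      then obtain z where z: "v = [:- w, 1:] * z"
        by (auto simp: poly_eq_0_iff_dvd)
      have "v \<noteq> 0" using linear_factor_degree[OF v u0] by blast
      then have "degree z = 0" "lead_coeff z = c"
        using linear_factor_degree[OF v u0] linear_factor_degree[OF z] u by simp_all
      then have "z = [:c:]"
        by (metis degree_eq_zeroE coeff_pCons_0 degree_pCons_0)
      then show ?thesis
        using v z by (simp only: mult.assoc mult.commute[of _ "[:c:]"] mult.left_commute[of _ "[:c:]"]) simp
    qed
    moreover obtain w1 n1 where "p = smult c ([:- w1, 1:] * [:m\<^sup>2 - n1, - 2 * m, 1:])" "n1 \<noteq> 0"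
      using mw(1) unfolding R2_def Q_def by blast
    moreover obtain w2 n2 where "p = smult c ([:- w2, 1:] * [:w\<^sup>2 - n2, - 2 * w, 1:])" "n2 \<noteq> 0"
      using mw(2) unfolding R2_def Q_def by blast
    moreover have "poly p x = 0" "poly u x = poly (pderiv p) x"
      "poly p y = 0" "poly u y = poly (pderiv p) y"
      using xy unfolding R1_def by blast+
    ultimately have "x = y"
      by (rule tangent_root_unique[OF c mw(3)])
    then show False
      using xy(3) by simp
  qed
  have fin: "finite ((\<lambda>m. u * [:- m, 1:]) ` R1 \<union> (\<lambda>m. SOME q. Q m q) ` R2)"
    using R1(1) R2(1) by (intro finite_UnI finite_imageI)
  have "card T \<le> card ((\<lambda>m. u * [:- m, 1:]) ` R1 \<union> (\<lambda>m. SOME q. Q m q) ` R2)"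
    by (rule card_mono[OF fin sub])
  also have "\<dots> \<le> card ((\<lambda>m. u * [:- m, 1:]) ` R1) + card ((\<lambda>m. SOME q. Q m q) ` R2)"
    by (rule card_Un_le)
  also have "\<dots> \<le> card R1 + card R2"
    by (intro add_mono card_image_le R1(1) R2(1))
  finally show ?thesis
    using R finite_subset[OF sub fin] by linarith
qed

section \<open>Solutions with a common leading coefficient\<close>

text \<open>The degree of \<open>q - p\<close> equals \<open>l\<close>, the quotient of
  \<open>lead_coeff A\<close> by the square of \<open>c\<close>, for every other \<open>q\<close>;
  so linear and quadratic differences cannot both occur. Three such \<open>q\<close> and
  \<open>p\<close> itself make four.\<close>

lemma card_same_lead:
  fixes A B :: "complex poly"
  assumes A: "degree A = 5" and pS: "p \<in> S"
    and S: "\<And>q. q \<in> S \<Longrightarrow> degree q = 3 \<and> lead_coeff q = c \<and> q * pderiv q + B * q + A = 0"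
  shows "finite S \<and> card S \<le> 4"
proof -
  have A0: "A \<noteq> 0" using A by auto
  have p: "degree p = 3" "lead_coeff p = c" "p * pderiv p + B * p + A = 0"
    using S[OF pS] by blast+
  have c: "c \<noteq> 0" "p \<noteq> 0"
    using p(1,2) leading_coeff_0_iff[of p] by (metis degree_0 zero_neq_numeral)+
  define h where "h = - pderiv p - B"
  have Ah: "A = p * h"
    using p(3) unfolding h_def by algebra
  have h0: "h \<noteq> 0"
    using Ah A0 by auto
  have degh: "degree h = 2"
    using A p(1) c h0 unfolding Ah by (simp add: degree_mult_eq)
  define l where "l = lead_coeff A / c\<^sup>2"
  have leadh: "lead_coeff h = l * c"
    using c p(2) unfolding l_def Ah by (simp add: lead_coeff_mult power2_eq_square)
  have step: "degree (q - p) \<in> {1,2} \<and> l = of_nat (degree (q - p)) \<and>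
      h * (q - p) = q * pderiv (q - p)" if "q \<in> S" "q \<noteq> p" for q
  proof -
    have q: "degree q = 3" "lead_coeff q = c" "q * pderiv q + B * q + A = 0"
      using S[OF that(1)] by blast+
    note * = reciprocal_solutions_degree[OF p(3) q(3) that(2)[symmetric] A0]
    have "degree (q - p) \<le> 3"
      using p q by (intro degree_diff_le) auto
    moreover have "degree (q - p) \<noteq> 3"
      using p q *(1) by (metis coeff_diff diff_self leading_coeff_0_iff degree_0 less_irrefl)
    ultimately have "degree (q - p) \<in> {1,2}"
      using *(1) by auto
    moreover have "l = of_nat (degree (q - p))"
      using *(3) p q c by (simp add: l_def power2_eq_square)
    moreover have "p * (h * (q - p)) = p * (q * pderiv (q - p))"
      using reciprocal_solutions_diff[OF p(3) q(3)] unfolding Ah by (simp only: ac_simps)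
    ultimately show ?thesis
      using c by simp
  qed
  have "finite (S - {p}) \<and> card (S - {p}) \<le> 3"
  proof (cases "l = 1")
    case True
    \<comment> \<open>The root \<open>m\<close> of the linear difference is a zero of
      \<open>q\<close>, hence of \<open>p\<close>, and it determines \<open>q\<close>.\<close>
    have "S - {p} \<subseteq> (\<lambda>m. h * [:- m, 1:]) ` {m. poly p m = 0}"
    proof
      fix q assume "q \<in> S - {p}"
      then have q: "degree (q - p) = 1" "h * (q - p) = q * pderiv (q - p)"
        using step[of q] True by auto
      then obtain a b where d: "q - p = [:b, a:]" "a \<noteq> 0"
        by (metis degree1_coeffs)
      define m where "m = - b / a"
      have dm: "q - p = smult a [:- m, 1:]"
        using d by (simp add: m_def)
      have "pderiv (q - p) = [:a:]"
        unfolding d(1) by (simp add: pderiv_pCons)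
      then have "h * smult a [:- m, 1:] = q * [:a:]"
        using q(2) dm by metis
      moreover have "q * [:a:] = smult a q"
        by simp
      ultimately have "smult a (h * [:- m, 1:]) = smult a q"
        by (simp only: mult_smult_right)
      then have qh: "q = h * [:- m, 1:]"
        using d(2) by (metis smult_cancel)
      have "p = q - smult a [:- m, 1:]"
        using dm by (simp add: algebra_simps)
      then have "poly p m = 0"
        by (simp add: qh)
      then show "q \<in> (\<lambda>m. h * [:- m, 1:]) ` {m. poly p m = 0}"
        using qh by blast
    qed
    moreover have "finite {m. poly p m = 0}" "card {m. poly p m = 0} \<le> 3"
      using finite_card_roots_le[OF c(2) order_refl] p by auto
    ultimately show ?thesis
      by (meson card_image_le card_mono finite_imageI finite_subset order_trans)
  next
    case False
    \<comment> \<open>Halving compensates the factor 2 from differentiating a quadratic difference;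
      when \<open>l = 2\<close>, it also gives \<open>u\<close> the leading coefficient
      \<open>c\<close>.\<close>
    define u where "u = smult (1 / 2) h"
    have hu: "h = smult 2 u" by (simp add: u_def)
    show ?thesis
    proof (cases "S - {p} = {}")
      case False
      then obtain q0 where "q0 \<in> S" "q0 \<noteq> p" by auto
      then have l2: "l = 2" using step[of q0] \<open>l \<noteq> 1\<close> by auto
      have u: "degree u = 2" "lead_coeff u = c"
        using degh leadh l2 by (simp_all add: u_def)
      show ?thesis
      proof (rule card_quadratic_steps[OF p(1,2) u])
        fix q assume qS: "q \<in> S - {p}"
        then have q: "degree (q - p) = 2" "h * (q - p) = q * pderiv (q - p)"
          using step[of q] l2 by auto
        then obtain a0 a1 e where d: "q - p = [:a0, a1, e:]" "e \<noteq> 0"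
          by (metis degree2_coeffs)
        \<comment> \<open>Completing the square: the roots of the difference are \<open>m\<close>
          plus and minus a square root of \<open>n\<close>.\<close>
        define m where "m = - a1 / (2 * e)"
        define n where "n = m\<^sup>2 - a0 / e"
        have dm: "q - p = smult e [:m\<^sup>2 - n, - 2 * m, 1:]"
          using d by (simp add: m_def n_def)
        have pd: "pderiv (q - p) = smult (2 * e) [:- m, 1:]"
          unfolding dm by (simp add: pderiv_smult pderiv_pCons)
        have "smult (2 * e) (u * [:m\<^sup>2 - n, - 2 * m, 1:]) = smult (2 * e) (q * [:- m, 1:])"
          using q(2) unfolding pd unfolding dm hu
          by (simp only: mult_smult_left mult_smult_right smult_smult mult.commute[of e 2])
        then have "u * [:m\<^sup>2 - n, - 2 * m, 1:] = q * [:- m, 1:]"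
          by (rule smult_cancel[rotated]) (simp add: d(2))
        moreover have "q = p + smult e [:m\<^sup>2 - n, - 2 * m, 1:]"
          using dm by (simp add: algebra_simps)
        ultimately show "\<exists>e m n. q = p + smult e [:m\<^sup>2 - n, - 2 * m, 1:] \<and>
            u * [:m\<^sup>2 - n, - 2 * m, 1:] = q * [:- m, 1:]"
          by blast
      qed
    next
      case True
      then show ?thesis
        by (metis card.empty finite.emptyI zero_le)
    qed
  qed
  then show ?thesis
    using card_Suc_Diff1[OF _ pS] by auto
qed

section \<open>Counting all polynomial solutions\<close>

text \<open>Unless two polynomials exhaust \<open>S\<close>, some leading coefficient occurs twice.
  Its class \<open>U\<close> has at most four members, and at most one solution lies outside
  it.\<close>

lemma card_reciprocal_solutions:
  fixes A B :: "complex poly"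
  assumes A: "degree A = 5"
  defines "S \<equiv> {p. p * pderiv p + B * p + A = 0}"
  shows "finite S \<and> card S \<le> 5"
proof (cases "\<exists>p q. p \<noteq> q \<and> S \<subseteq> {p, q}")
  case True
  then obtain p q where "S \<subseteq> {p, q}" by blast
  then show ?thesis
    using card_mono[of "{p, q}" S] finite_subset[of S "{p, q}"] card_length[of "[p, q]"] by simp
next
  case False
  have A0: "A \<noteq> 0" using A by auto
  have avoid: "\<exists>x\<in>S. x \<noteq> p \<and> x \<noteq> q" for p q
  proof (cases "p = q")
    case True
    \<comment> \<open>\<open>p + 1\<close> is only a filler: the case assumption speaks of pairs of
      distinct polynomials.\<close>
    then have "\<not> S \<subseteq> {p, p + 1}"
      using False by (metis add_cancel_left_right one_neq_zero)
    then show ?thesis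
      using True by blast
  next
    case neq: False
    then have "\<not> S \<subseteq> {p, q}"
      using False by blast
    then show ?thesis
      by blast
  qed
  note deg = reciprocal_solutions_degree[OF _ _ _ A0, unfolded A]
  have Sd: "p * pderiv p + B * p + A = 0" if "p \<in> S" for p
    using that by (simp add: S_def)
  \<comment> \<open>The three pairwise degree sums of three distinct solutions all equal 6.\<close>
  have deg3: "degree p = 3" if "p \<in> S" for p
  proof -
    obtain q where q: "q \<in> S" "q \<noteq> p" using avoid by blast
    obtain r where r: "r \<in> S" "r \<noteq> p" "r \<noteq> q" using avoid by blast
    show ?thesis
      using deg(2)[of p B q] deg(2)[of p B r] deg(2)[of q B r] q r that Sd by force
  qed
  have l0: "lead_coeff p \<noteq> 0" if "p \<in> S" for p
    using deg3[OF that] leading_coeff_0_iff[of p] by (metis degree_0 zero_neq_numeral)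
  have same: "\<exists>k::nat. k \<in> {1,2} \<and> lead_coeff A = of_nat k * (lead_coeff p)\<^sup>2"
    if "p \<in> S" "q \<in> S" "p \<noteq> q" "lead_coeff p = lead_coeff q" for p q
  proof -
    have "degree (q - p) \<le> 3"
      using deg3 that by (intro degree_diff_le) auto
    moreover have "0 < degree (q - p)" using deg(1) that Sd by blast
    moreover have "degree (q - p) \<noteq> 3"
      using that deg3 calculation by (metis coeff_diff diff_self leading_coeff_0_iff degree_0 less_irrefl)
    ultimately have "degree (q - p) \<in> {1,2}" by auto
    then show ?thesis
      using deg(3)[of p B q] that Sd by (auto simp: A power2_eq_square)
  qed
  have diff: "lead_coeff A = 3 * lead_coeff p * lead_coeff q"
    if "p \<in> S" "q \<in> S" "lead_coeff p \<noteq> lead_coeff q" for p q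
  proof -
    have "coeff (q - p) 3 \<noteq> 0" using that deg3 by auto
    then have "degree (q - p) \<ge> 3" by (rule le_degree)
    moreover have "degree (q - p) \<le> 3"
      using deg3 that by (intro degree_diff_le) auto
    ultimately have "degree (q - p) = 3" by simp
    moreover have "p \<noteq> q" using that by auto
    ultimately show ?thesis
      using deg(3)[of p B q] that Sd by (auto simp: A)
  qed
  \<comment> \<open>Among three solutions, if \<open>p\<close> differs from \<open>q\<close> and
    \<open>r\<close> in leading coefficient, then \<open>diff\<close> gives \<open>q\<close> and
    \<open>r\<close> the same one.\<close>
  have "\<exists>p\<in>S. \<exists>q\<in>S. p \<noteq> q \<and> lead_coeff p = lead_coeff q"
  proof (rule ccontr)
    assume *: "\<not> ?thesis"
    obtain p where p: "p \<in> S" using avoid by blast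
    obtain q where q: "q \<in> S" "q \<noteq> p" using avoid by blast
    obtain r where r: "r \<in> S" "r \<noteq> p" "r \<noteq> q" using avoid by blast
    have "3 * lead_coeff p * lead_coeff q = 3 * lead_coeff p * lead_coeff r"
      using diff[of p q] diff[of p r] * p q r by metis
    then have "lead_coeff q = lead_coeff r"
      using l0[OF p] by simp
    then show False using * q r by metis
  qed
  then obtain p p' where p: "p \<in> S" "p' \<in> S" "p \<noteq> p'" "lead_coeff p = lead_coeff p'"
    by blast
  define c where "c = lead_coeff p"
  define U where "U = {q \<in> S. lead_coeff q = c}"
  define V where "V = {q \<in> S. lead_coeff q \<noteq> c}"
  have U: "finite U \<and> card U \<le> 4"
    by (rule card_same_lead[OF A, of p]) (use p Sd deg3 in \<open>auto simp: U_def c_def\<close>)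
  \<comment> \<open>By \<open>diff\<close>, \<open>r\<close> and \<open>s\<close> have a common
    leading coefficient d with \<open>lead_coeff A\<close> = 3cd. If they were distinct,
    \<open>same\<close> would give k d^2 = 3cd = j c^2, hence jk = 9, which is impossible for j and
    k in {1,2}.\<close>
  have V: "r = s" if "r \<in> V" "s \<in> V" for r s
  proof (rule ccontr)
    assume "r \<noteq> s"
    have rs: "r \<in> S" "s \<in> S" "lead_coeff r \<noteq> c" "lead_coeff s \<noteq> c"
      using that by (auto simp: V_def)
    have 1: "lead_coeff A = 3 * c * lead_coeff r" "lead_coeff A = 3 * c * lead_coeff s"
      using diff p rs unfolding c_def by metis+
    then have "lead_coeff r = lead_coeff s"
      using l0[OF p(1)] by (simp add: c_def)
    then obtain k where k: "k \<in> {1,2::nat}" "lead_coeff A = of_nat k * (lead_coeff r)\<^sup>2"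
      using same rs \<open>r \<noteq> s\<close> by blast
    obtain j where j: "j \<in> {1,2::nat}" "lead_coeff A = of_nat j * c\<^sup>2"
      using same p unfolding c_def by blast
    have c: "c \<noteq> 0" "lead_coeff r \<noteq> 0" using l0 p rs by (auto simp: c_def)
    have "c * (of_nat j * c) = c * (3 * lead_coeff r)"
      using 1(1) j(2) by (simp only: power2_eq_square ac_simps)
    then have a: "of_nat j * c = 3 * lead_coeff r" using c(1) mult_left_cancel by blast
    have "lead_coeff r * (of_nat k * lead_coeff r) = lead_coeff r * (3 * c)"
      using 1(1) k(2) by (simp only: power2_eq_square ac_simps)
    then have b: "of_nat k * lead_coeff r = 3 * c" using c(2) mult_left_cancel by blast
    have "c * of_nat (j * k) = c * 9"
    proof -
      have "c * of_nat (j * k) = of_nat k * (of_nat j * c)"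
        by simp
      also have "\<dots> = 3 * (of_nat k * lead_coeff r)"
        by (simp only: a mult.left_commute)
      finally show ?thesis
        by (simp add: b)
    qed
    then have "of_nat (j * k) = (9 :: complex)" using c(1) mult_left_cancel by blast
    then show False
      using j k by auto
  qed
  have "V = {} \<or> (\<exists>v. V = {v})" using V by blast
  then have "finite V \<and> card V \<le> 1" by auto
  moreover have "S = U \<union> V" by (auto simp: U_def V_def)
  ultimately show ?thesis
    using U card_Un_le[of U V] by auto
qed

theorem proposition4p6:
  fixes A B :: "complex poly"
  assumes "degree A = 5"
  shows "finite {x. rational_solution A B x} \<and> card {x. rational_solution A B x} \<le> 5"
proof -
  let ?S = "{p. p * pderiv p + B * p + A = 0}"
  have "{x. rational_solution A B x} \<subseteq> (\<lambda>p t. 1 / poly p t) ` ?S"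
    using rational_solution_imp_reciprocal by blast
  moreover have "finite ?S" "card ?S \<le> 5"
    using card_reciprocal_solutions[OF assms] by auto
  ultimately show ?thesis
    by (meson card_image_le card_mono finite_imageI finite_subset order_trans)
qed

end
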